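(* Let $\mathbf{A}\in\mathbb{R}^{n\times d}$, $\lambda>0$, $p,q\ge 1$ and $r,s>0$ with $r\neq s$, and let $\epsilon>0$. Let $\mathbf{A}_c$ be any real matrix with $d$ columns that is an $\epsilon$-coreset for $\|\mathbf{A}\mathbf{x}\|_p^r+\lambda\|\mathbf{x}\|_q^s$, i.e. for all $\mathbf{x}\in\mathbb{R}^d$, $$(1-\epsilon)\left(\|\mathbf{A}\mathbf{x}\|_p^r+\lambda\|\mathbf{x}\|_q^s\right)\le \|\mathbf{A}_c\mathbf{x}\|_p^r+\lambda\|\mathbf{x}\|_q^s\le(1+\epsilon)\left(\|\mathbf{A}\mathbf{x}\|_p^r+\lambda\|\mathbf{x}\|_q^s\right).$$ Then $\mathbf{A}_c$ is also an $\epsilon$-coreset for $\|\mathbf{A}\mathbf{x}\|_p^r$, i.e. for all $\mathbf{x}\in\mathbb{R}^d$, $$(1-\epsilon)\|\mathbf{A}\mathbf{x}\|_p^r\le\|\mathbf{A}_c\mathbf{x}\|_p^r\le(1+\epsilon)\|\mathbf{A}\mathbf{x}\|_p^r.$$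
   Context: For a vector $\mathbf{y}$, $\|\mathbf{y}\|_p=(\sum_j|y_j|^p)^{1/p}$. Here a coreset $\mathbf{A}_c$ is any matrix (with any number of rows) satisfying the stated coreset inequality; its rows need not be sampled or rescaled rows of $\mathbf{A}$. *)

theory Defs
  imports Complex_Main "Jordan_Normal_Form.Matrix"
begin

(* The norm is raised to positive real powers below; since "0 powr a = 0" in Isabelle,
   powr agrees with the usual power on all nonnegative bases when the exponent is positive. *)
definition vec_pnorm :: "real \<Rightarrow> real vec \<Rightarrow> real" where
  "vec_pnorm p y = (\<Sum>j<dim_vec y. \<bar>y $ j\<bar> powr p) powr (1 / p)"

definition lp_objective :: "real \<Rightarrow> real \<Rightarrow> real mat \<Rightarrow> real vec \<Rightarrow> real" where
  "lp_objective p r A x = vec_pnorm p (A *\<^sub>v x) powr r"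

definition reg_objective ::
  "real \<Rightarrow> real \<Rightarrow> real \<Rightarrow> real \<Rightarrow> real \<Rightarrow> real mat \<Rightarrow> real vec \<Rightarrow> real" where
  "reg_objective p r lam q s A x = vec_pnorm p (A *\<^sub>v x) powr r + lam * vec_pnorm q x powr s"

(* "F M x" is the objective with data matrix M at the point x. The matrix Ac may have any
   number of rows, and they need not be related to the rows of A. *)
definition is_coreset ::
  "(real mat \<Rightarrow> real vec \<Rightarrow> real) \<Rightarrow> real \<Rightarrow> real mat \<Rightarrow> real mat \<Rightarrow> bool" where
  "is_coreset F eps A Ac \<longleftrightarrow>
     dim_col Ac = dim_col A \<and>
     (\<forall>x \<in> carrier_vec (dim_col A).
        (1 - eps) * F A x \<le> F Ac x \<and> F Ac x \<le> (1 + eps) * F A x)"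

end

(* Replacing x by t x multiplies the two terms of the objective by t powr r and t powr s.
   After division by t powr r the regularizer carries the factor t powr (s - r), and since
   r and s differ this factor takes every positive value, in particular arbitrarily small ones. *)
theory Submission imports Defs begin

lemma vec_pnorm_smult:
  assumes "t \<ge> 0" and "p \<noteq> 0"
  shows "vec_pnorm p (t \<cdot>\<^sub>v y) = t * vec_pnorm p y"
proof -
  have "(\<Sum>j<dim_vec (t \<cdot>\<^sub>v y). \<bar>(t \<cdot>\<^sub>v y) $ j\<bar> powr p)
      = t powr p * (\<Sum>j<dim_vec y. \<bar>y $ j\<bar> powr p)"
    using assms by (simp add: abs_mult powr_mult sum_distrib_left)
  then show ?thesis
    using assms by (simp add: vec_pnorm_def powr_mult powr_powr sum_nonneg)
qed

lemma vec_pnorm_nonneg: "vec_pnorm p y \<ge> 0"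
  by (simp add: vec_pnorm_def)

lemma lp_objective_smult:
  assumes "t \<ge> 0" and "p \<noteq> 0" and "x \<in> carrier_vec (dim_col M)"
  shows "lp_objective p r M (t \<cdot>\<^sub>v x) = t powr r * lp_objective p r M x"
proof -
  have "M *\<^sub>v (t \<cdot>\<^sub>v x) = t \<cdot>\<^sub>v (M *\<^sub>v x)"
    using assms(3) by (intro mult_mat_vec) auto
  then show ?thesis
    using assms by (simp add: lp_objective_def vec_pnorm_smult powr_mult vec_pnorm_nonneg)
qed

text \<open>Writing \<open>t powr s\<close> as \<open>t powr r * t powr (s - r)\<close> lets the
  factor \<open>t powr r\<close> come out of both terms. What remains is the unregularized objective
  at \<open>x\<close>, with \<open>t\<close> entering only through the weight of the
  regularizer.\<close>

lemma reg_objective_smult: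
  assumes "t > 0" and "p \<noteq> 0" and "q \<noteq> 0" and "x \<in> carrier_vec (dim_col M)"
  shows "reg_objective p r lam q s M (t \<cdot>\<^sub>v x)
    = t powr r * (lp_objective p r M x + t powr (s - r) * (lam * vec_pnorm q x powr s))"
proof -
  have "reg_objective p r lam q s M (t \<cdot>\<^sub>v x)
      = t powr r * lp_objective p r M x + t powr s * (lam * vec_pnorm q x powr s)"
    using assms lp_objective_smult[of t p x M r]
    by (simp add: reg_objective_def lp_objective_def vec_pnorm_smult powr_mult vec_pnorm_nonneg)
  also have "t powr s = t powr r * t powr (s - r)"
    by (simp flip: powr_add)
  finally show ?thesis
    by (simp add: algebra_simps)
qed

text \<open>The bound tends to 0 as \<open>u\<close> tends to 0 from the right, whatever the sign of
  \<open>k\<close>, while \<open>a\<close> stays fixed.\<close>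

lemma nonpos_if_le_all_pos_multiples:
  fixes a k :: real
  assumes "\<And>u. u > 0 \<Longrightarrow> a \<le> u * k"
  shows "a \<le> 0"
proof (rule tendsto_lowerbound)
  show "((\<lambda>u. u * k) \<longlongrightarrow> 0) (at_right 0)"
    by (auto intro!: tendsto_eq_intros)
  show "\<forall>\<^sub>F u in at_right 0. a \<le> u * k"
    using assms by (simp add: eventually_at_right_less eventually_at_filter)
qed simp

theorem theorem4p1:
  fixes A Ac :: "real mat" and n m d :: nat and lam p q r s eps :: real
  assumes "A \<in> carrier_mat n d"
    and "Ac \<in> carrier_mat m d"
    and "lam > 0"
    and "p \<ge> 1" and "q \<ge> 1"
    and "r > 0" and "s > 0" and "r \<noteq> s"
    and "eps > 0"
    and "is_coreset (reg_objective p r lam q s) eps A Ac"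
  shows "is_coreset (lp_objective p r) eps A Ac"
proof -
  let ?L = "lp_objective p r" and ?R = "reg_objective p r lam q s"
  have dim: "dim_col Ac = dim_col A"
    using assms(1,2) by simp
  have "(1 - eps) * ?L A x \<le> ?L Ac x \<and> ?L Ac x \<le> (1 + eps) * ?L A x"
    if x: "x \<in> carrier_vec (dim_col A)" for x
  proof -
    define b where "b = lam * vec_pnorm q x powr s"
    \<comment> \<open>Both matrices share the regularizer, so weighting it by \<open>u\<close> and
      cancelling \<open>u * b\<close> leaves the same error \<open>eps * u * b\<close> on either
      side.\<close>
    have bounds: "(1 - eps) * ?L A x - ?L Ac x \<le> u * (eps * b)"
        "?L Ac x - (1 + eps) * ?L A x \<le> u * (eps * b)" if "u > 0" for u
    proof -
      \<comment> \<open>This solves \<open>t powr (s - r) = u\<close>, which is possible because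
        \<open>r \<noteq> s\<close>. As \<open>u\<close> shrinks to 0, \<open>t\<close> tends to 0
        if \<open>s > r\<close> and to infinity if \<open>s < r\<close>.\<close>
      define t where "t = u powr (1 / (s - r))"
      have t: "t > 0" and u: "t powr (s - r) = u"
        using \<open>u > 0\<close> \<open>r \<noteq> s\<close> by (auto simp: t_def powr_powr)
      have R: "?R M (t \<cdot>\<^sub>v x) = t powr r * (?L M x + u * b)" if "dim_col M = dim_col A" for M
        using reg_objective_smult[of t p q x M r lam s] t u x that assms(4,5)
        by (simp add: b_def)
      \<comment> \<open>The coreset hypothesis is used at the rescaled point, not at
        \<open>x\<close> itself.\<close>
      have "(1 - eps) * ?R A (t \<cdot>\<^sub>v x) \<le> ?R Ac (t \<cdot>\<^sub>v x)"
          "?R Ac (t \<cdot>\<^sub>v x) \<le> (1 + eps) * ?R A (t \<cdot>\<^sub>v x)"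
        using assms(10) x by (auto simp: is_coreset_def)
      \<comment> \<open>The factor \<open>t powr r\<close> is moved to the front of every side,
        where it cancels because it is positive.\<close>
      then have "t powr r * ((1 - eps) * (?L A x + u * b)) \<le> t powr r * (?L Ac x + u * b)"
          "t powr r * (?L Ac x + u * b) \<le> t powr r * ((1 + eps) * (?L A x + u * b))"
        by (simp_all only: R dim mult.left_commute)
      then have "(1 - eps) * (?L A x + u * b) \<le> ?L Ac x + u * b"
          "?L Ac x + u * b \<le> (1 + eps) * (?L A x + u * b)"
        using t by simp_all
      then show "(1 - eps) * ?L A x - ?L Ac x \<le> u * (eps * b)"
          "?L Ac x - (1 + eps) * ?L A x \<le> u * (eps * b)"
        by (simp_all add: algebra_simps)
    qed
    \<comment> \<open>The left sides of \<open>bounds\<close> do not involve \<open>u\<close>, so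
      \<open>u\<close> can be sent to 0.\<close>
    show ?thesis
      using nonpos_if_le_all_pos_multiples[OF bounds(1)]
        nonpos_if_le_all_pos_multiples[OF bounds(2)] by simp
  qed
  with dim show ?thesis
    by (simp add: is_coreset_def)
qed

end
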